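(* Let $\delta>0$ be fixed. For each integer $n\ge0$ the following asymptotic expansion holds: $$\zeta_E'(-n,q)\sim\frac14 q^{n-1}-\frac12E_n(q)\log q-\frac12\sum_{k=1}^\infty E_{2k+1}(0)\sum_{j=0}^{\min(n,2k)}\binom nj\frac{(-1)^j}{2k-j+1}\,q^{n-2k-1}$$ as $|q|\to\infty$ in the sector $|\arg q|\le\pi-\delta$.
   Context: For $|\arg q|<\pi$, $\zeta_E(s,q)$ denotes the alternating Hurwitz zeta function, defined for $\mathrm{Re}(s)>0$ by $\zeta_E(s,q)=\sum_{n=0}^\infty \frac{(-1)^n}{(n+q)^s}$ (principal branches) and extended to an entire function of $s\in\mathbb C$ by analytic continuation; $\zeta_E'(-n,q)=\frac{\partial}{\partial s}\zeta_E(s,q)\big|_{s=-n}$. $E_n(x)$ are the Euler polynomials, $\frac{2e^{xt}}{e^t+1}=\sum_{n\ge0}E_n(x)\frac{t^n}{n!}$ for $|t|<\pi$. $\log q$ is the principal value. The symbol $\sim$ means asymptotic expansion in the Poincaré sense: for each integer $K\ge0$, the difference between the left side and the right side with the infinite series in $k$ truncated after $k=K$ is $O(|q|^{n-2K-3})$ as $|q|\to\infty$ in the sector, the implied constant depending only on $n,\delta,K$. *)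

theory Defs
  imports "HOL-Complex_Analysis.Complex_Analysis" "HOL-Library.Landau_Symbols"
begin

text \<open>
  The entire function of \<open>s\<close> that continues the alternating series from the half-plane
  \<open>Re s > 0\<close>; it is unique by the identity theorem. Here \<open>powr\<close> is the principal branch and
  \<open>sums\<close> is ordered (conditional) summation, since the series is only conditionally
  convergent for \<open>Re s \<le> 1\<close>. The definition is intended for \<open>q\<close> off the closed negative
  real axis.
\<close>
definition alt_hurwitz_zeta :: "complex \<Rightarrow> complex \<Rightarrow> complex" where
  "alt_hurwitz_zeta s q =
     (THE f. f holomorphic_on UNIV \<and>
        (\<forall>z. Re z > 0 \<longrightarrow> (\<lambda>n. (-1) ^ n / (of_nat n + q) powr z) sums f z)) s"

text \<open>
  The generating function is read as a formal power series in \<open>t\<close>; the lemma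
  \<open>euler_poly_sums\<close> below recovers the analytic identity on the disc \<open>|t| < pi\<close>.
\<close>
definition euler_poly :: "nat \<Rightarrow> complex \<Rightarrow> complex" where
  "euler_poly n x = fact n * fps_nth (2 * fps_exp x / (fps_exp 1 + 1)) n"

lemma euler_poly_sums:
  fixes x t :: complex
  assumes "norm t < pi"
  shows "(\<lambda>n. euler_poly n x * (t ^ n / fact n)) sums (2 * exp (x * t) / (exp t + 1))"
proof -
  let ?f = "\<lambda>t::complex. 2 * exp (x * t) / (exp t + 1)"
  let ?F = "2 * fps_exp x / (fps_exp 1 + 1) :: complex fps"
  have nz: "exp u + 1 \<noteq> 0" if "norm u < pi" for u :: complex
  proof
    assume "exp u + 1 = 0"
    hence "exp u = exp (\<i> * of_real pi)"
      by (simp add: eq_neg_iff_add_eq_0)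
    then obtain k :: int where k: "u = \<i> * of_real pi + (of_int (2 * k) * of_real pi) * \<i>"
      unfolding exp_eq by auto
    hence "u = of_real (of_int (2 * k + 1) * pi) * \<i>"
      by (simp add: algebra_simps)
    hence "norm u = \<bar>of_int (2 * k + 1)\<bar> * pi"
      by (simp only: norm_mult norm_of_real norm_ii abs_mult) simp
    moreover have "\<bar>2 * k + 1\<bar> \<ge> 1"
      by presburger
    hence "\<bar>of_int (2 * k + 1)\<bar> \<ge> (1::real)"
      by linarith
    hence "\<bar>of_int (2 * k + 1)\<bar> * pi \<ge> 1 * pi"
      by (intro mult_right_mono) auto
    ultimately show False
      using that by simp
  qed
  have exp: "?f has_fps_expansion ?F"
    by (intro fps_expansion_intros) auto
  have "?f holomorphic_on eball 0 (ereal pi)"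
    by (intro holomorphic_intros) (use nz in auto)
  from has_fps_expansion_imp_sums_complex[OF exp this, of t] assms
  show ?thesis
    by (simp add: euler_poly_def)
qed

text \<open>\<open>Arg\<close> takes values in \<open>(-pi, pi]\<close>, with the convention \<open>Arg 0 = 0\<close>.\<close>
definition arg_sector :: "real \<Rightarrow> complex set" where
  "arg_sector \<delta> = {q. q \<noteq> 0 \<and> \<bar>Arg q\<bar> \<le> pi - \<delta>}"

end

theory Submission
  imports Defs
begin

text \<open>
  Boole summation suggests the approximation
  \<open>A\<^sub>m(s,q) = 1/2 (\<Sum>k<m. E\<^sub>k(0) (-s choose k) q powr (-s - k))\<close> of \<open>\<zeta>\<^sub>E(s,q)\<close>. Its defect
  \<open>h\<^sub>m(s,q) = q powr (-s) - A\<^sub>m(s,q) - A\<^sub>m(s,q+1)\<close> in the functional equation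
  \<open>\<zeta>\<^sub>E(s,q) + \<zeta>\<^sub>E(s,q+1) = q powr (-s)\<close> equals \<open>q powr (-s)\<close> times a function of \<open>u = 1/q\<close> that is
  holomorphic in the unit disc and, by the recurrence for the numbers \<open>E\<^sub>k(0)\<close>, vanishes to order
  \<open>m\<close> at \<open>u = 0\<close>. Telescoping gives \<open>\<zeta>\<^sub>E(s,q) - A\<^sub>m(s,q) = (\<Sum>j. (-1)^j h\<^sub>m(s,q+j))\<close>, and for large \<open>m\<close>
  this series converges absolutely and uniformly for bounded \<open>s\<close>: it provides the analytic
  continuation as well as the error bound. The error bound passes to the derivative in \<open>s\<close> by
  Cauchy's inequality on a disc of radius 1 around \<open>-n\<close>, and \<open>A\<^sub>m\<close> is differentiated
  explicitly. No integral representation is needed because \<open>m\<close> may be taken much larger than the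
  requested order, the superfluous terms being absorbed into the error.
\<close>

subsection \<open>Euler polynomials and generalised binomial coefficients\<close>

definition euler_egf :: "complex fps" where
  "euler_egf = 2 / (fps_exp 1 + 1)"

lemma euler_poly_0_conv_egf: "euler_poly k 0 = fact k * fps_nth euler_egf k"
  by (simp add: euler_poly_def euler_egf_def)

lemma euler_egf_mult: "euler_egf * (fps_exp 1 + 1) = 2"
proof -
  have "fps_nth (fps_exp 1 + 1 :: complex fps) 0 \<noteq> 0"
    by simp
  then show ?thesis
    by (simp add: euler_egf_def fps_divide_unit mult.assoc inverse_mult_eq_1)
qed

text \<open>Compares the coefficients of t^N in (e^t + 1) * 2/(e^t + 1) = 2, scaled by N!. This
  identity makes the low-order terms of \<open>boole_factor\<close> cancel.\<close>

lemma euler_poly_0_recurrence: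
  "euler_poly N 0 + (\<Sum>k\<le>N. of_nat (N choose k) * euler_poly k 0) = (if N = 0 then 2 else 0)"
proof -
  have "fps_nth (euler_egf * (fps_exp 1 + 1)) N = (if N = 0 then 2 else 0)"
    by (simp only: euler_egf_mult fps_numeral_nth)
  then have "fps_nth euler_egf N + (\<Sum>k\<le>N. fps_nth euler_egf k / fact (N - k)) = (if N = 0 then 2 else 0)"
    by (simp add: distrib_left fps_mult_nth add.commute atMost_atLeast0)
  then have "fact N * (fps_nth euler_egf N + (\<Sum>k\<le>N. fps_nth euler_egf k / fact (N - k))) = (if N = 0 then 2 else 0)"
    by simp
  moreover have "of_nat (N choose k) * euler_poly k 0 = fact N * (fps_nth euler_egf k / fact (N - k))"
    if "k \<le> N" for k
    using that by (simp add: binomial_fact euler_poly_0_conv_egf)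
  ultimately show ?thesis
    by (simp add: euler_poly_0_conv_egf distrib_left sum_distrib_left)
qed

lemma euler_poly_0_values: "euler_poly 0 0 = 1" "euler_poly (Suc 0) 0 = - 1 / 2"
proof -
  show "euler_poly 0 0 = 1"
    using euler_poly_0_recurrence[of 0] by simp
  then have "2 * euler_poly (Suc 0) 0 = - 1"
    using euler_poly_0_recurrence[of 1] by (simp add: eq_neg_iff_add_eq_0)
  then show "euler_poly (Suc 0) 0 = - 1 / 2"
    by (simp add: field_simps)
qed

text \<open>Replacing \<open>t\<close> by \<open>-t\<close> in \<open>2/(e^t + 1)\<close> gives \<open>2 - 2/(e^t + 1)\<close>.\<close>
lemma euler_poly_0_even:
  assumes "i > 0"
  shows "euler_poly (2 * i) 0 = 0"
proof -
  have nz: "(fps_exp 1 + 1 :: complex fps) \<noteq> 0"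
  proof
    assume "fps_exp 1 + 1 = (0 :: complex fps)"
    from arg_cong[OF this, of "\<lambda>F. fps_nth F 0"] show False
      by simp
  qed
  have "(euler_egf oo - fps_X) * (fps_exp (-1) + 1) = 2"
  proof -
    have "(euler_egf * (fps_exp 1 + 1)) oo - fps_X = (euler_egf oo - fps_X) * ((fps_exp 1 + 1) oo - fps_X)"
      by (rule fps_compose_mult_distrib) simp
    moreover have "(fps_exp 1 + 1 :: complex fps) oo - fps_X = fps_exp (-1) + 1"
      by (simp add: fps_compose_add_distrib)
    moreover have "(2 :: complex fps) oo - fps_X = 2"
      by (simp add: fps_compose_uminus' fps_eq_iff fps_numeral_nth)
    ultimately show ?thesis
      by (simp only: euler_egf_mult)
  qed
  then have "(euler_egf oo - fps_X) * ((fps_exp (-1) + 1) * fps_exp 1) = 2 * fps_exp 1"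
    by (simp only: mult.assoc [symmetric])
  also have "(fps_exp (-1) + 1) * fps_exp (1::complex) = fps_exp 1 + 1"
    by (simp add: distrib_right flip: fps_exp_add_mult)
  also have "2 * fps_exp (1::complex) = (2 - euler_egf) * (fps_exp 1 + 1)"
    by (simp only: left_diff_distrib euler_egf_mult) (simp add: distrib_left)
  finally have "euler_egf oo - fps_X = 2 - euler_egf"
    using nz by simp
  then have "fps_nth (euler_egf oo - fps_X) (2 * i) = fps_nth (2 - euler_egf) (2 * i)"
    by simp
  with assms have "2 * fps_nth euler_egf (2 * i) = 0"
    by (simp add: fps_compose_uminus' fps_numeral_nth)
  then show ?thesis
    by (simp add: euler_poly_0_conv_egf)
qed

text \<open>Cauchy product of 2/(e^t + 1) and e^(xt). It serves to recognise the collected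
  logarithmic terms as a multiple of E_n(q).\<close>

lemma euler_poly_expand:
  "euler_poly n x = (\<Sum>k\<le>n. of_nat (n choose k) * euler_poly k 0 * x ^ (n - k))"
proof -
  have "fps_nth (fps_exp 1 + 1 :: complex fps) 0 \<noteq> 0"
    by simp
  then have "2 * fps_exp x / (fps_exp 1 + 1) = euler_egf * fps_exp x"
    by (simp add: euler_egf_def fps_divide_unit mult_ac)
  then have "euler_poly n x = (\<Sum>k\<le>n. fact n * (fps_nth euler_egf k * (x ^ (n - k) / fact (n - k))))"
    by (simp add: euler_poly_def fps_mult_nth sum_distrib_left atMost_atLeast0)
  also have "\<dots> = (\<Sum>k\<le>n. of_nat (n choose k) * euler_poly k 0 * x ^ (n - k))"
    by (intro sum.cong refl) (simp add: binomial_fact euler_poly_0_conv_egf)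
  finally show ?thesis .
qed

section \<open>Generalised binomial coefficients as functions of the upper argument\<close>

lemma holomorphic_on_gbinomial [holomorphic_intros]:
  assumes "f holomorphic_on A"
  shows "(\<lambda>z. f z gchoose k) holomorphic_on A"
  unfolding gbinomial_prod_rev by (intro holomorphic_intros assms) auto

lemma continuous_on_gbinomial [continuous_intros]:
  fixes f :: "'a::topological_space \<Rightarrow> complex"
  assumes "continuous_on A f"
  shows "continuous_on A (\<lambda>z. f z gchoose k)"
  unfolding gbinomial_prod_rev by (intro continuous_intros assms) auto

text \<open>For i > 0 the absorption identity pulls out a factor h, so the derivative at 0 is the
  value of the cofactor there, (-1 choose i - 1) / i.\<close>

lemma has_field_derivative_gbinomial_0:
  "((\<lambda>h::complex. h gchoose i) has_field_derivative (if i = 0 then 0 else (-1) ^ (i - 1) / of_nat i)) (at 0)"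
proof (cases i)
  case (Suc l)
  have eq: "(h gchoose i) = h * ((h - 1) gchoose l) / of_nat i" for h :: complex
    using gbinomial_absorption[of l h] Suc by (simp add: field_simps del: of_nat_Suc)
  then have eq': "(\<lambda>h::complex. h gchoose i) = (\<lambda>h. h * ((h - 1) gchoose l) / of_nat i)"
    by (rule ext)
  have "(\<lambda>h::complex. (h - 1) gchoose l) holomorphic_on UNIV"
    by (intro holomorphic_intros)
  \<comment> \<open>Mere differentiability of the cofactor suffices: the product rule multiplies D
    by h = 0.\<close>
  then obtain D where D: "((\<lambda>h::complex. (h - 1) gchoose l) has_field_derivative D) (at 0)"
    using field_differentiable_def holomorphic_on_imp_differentiable_at open_UNIV by blast
  have "((\<lambda>h::complex. h * ((h - 1) gchoose l) / of_nat i) has_field_derivative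
          (1 * ((0 - 1) gchoose l) + D * 0) / of_nat i) (at 0)"
    by (intro DERIV_cdivide DERIV_mult D DERIV_ident)
  moreover have "((-1 :: complex) gchoose l) = (-1) ^ l"
    using gbinomial_minus[of "1::complex" l] by (simp flip: binomial_gbinomial)
  ultimately show ?thesis
    unfolding eq' by (simp add: Suc)
qed auto

text \<open>Vandermonde's identity recentres at n and reduces the claim to derivatives at 0. The
  inner sums over j of the expansion originate here.\<close>

lemma has_field_derivative_gbinomial_of_nat:
  "((\<lambda>w::complex. w gchoose k) has_field_derivative
     (\<Sum>j<k. of_nat (n choose j) * ((-1) ^ (k - j - 1) / of_nat (k - j)))) (at (of_nat n))"
proof -
  have eq: "(\<lambda>w::complex. w gchoose k) =
        (\<lambda>w. \<Sum>j\<in>{0..k}. of_nat (n choose j) * ((w - of_nat n) gchoose (k - j)))"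
    using gbinomial_Vandermonde[of "of_nat n :: complex" "_ - of_nat n" k]
    by (simp add: binomial_gbinomial fun_eq_iff)
  have "((\<lambda>w::complex. \<Sum>j\<in>{0..k}. of_nat (n choose j) * ((w - of_nat n) gchoose (k - j)))
     has_field_derivative (\<Sum>j\<in>{0..k}. of_nat (n choose j) *
       (if k - j = 0 then 0 else (-1) ^ (k - j - 1) / of_nat (k - j)))) (at (of_nat n))"
  proof (intro DERIV_sum DERIV_cmult)
    fix j
    show "((\<lambda>w::complex. (w - of_nat n) gchoose (k - j)) has_field_derivative
       (if k - j = 0 then 0 else (-1) ^ (k - j - 1) / of_nat (k - j))) (at (of_nat n))"
    proof -
      have "((\<lambda>w::complex. w - of_nat n) has_field_derivative 1) (at (of_nat n))"
        by (auto intro!: derivative_eq_intros)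
      from DERIV_chain'[OF this, of "\<lambda>h. h gchoose (k - j)"] has_field_derivative_gbinomial_0[of "k - j"]
      show ?thesis
        by (simp del: of_nat_diff)
    qed
  qed
  also have "(\<Sum>j\<in>{0..k}. of_nat (n choose j) *
       (if k - j = 0 then 0 else (-1) ^ (k - j - 1) / of_nat (k - j))) =
     (\<Sum>j<k. of_nat (n choose j) * ((-1) ^ (k - j - 1) / of_nat (k - j) :: complex))"
    by (rule sum.mono_neutral_cong_right) auto
  finally show ?thesis
    by (simp add: eq)
qed

subsection \<open>Boole summation\<close>

definition boole_sum :: "nat \<Rightarrow> complex \<Rightarrow> complex \<Rightarrow> complex" where
  "boole_sum m s q = (\<Sum>k<m. euler_poly k 0 * (- s gchoose k) * q powr (- s - of_nat k)) / 2"

definition boole_defect :: "nat \<Rightarrow> complex \<Rightarrow> complex \<Rightarrow> complex" where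
  "boole_defect m s q = q powr (- s) - boole_sum m s q - boole_sum m s (q + 1)"

text \<open>The defect divided by \<open>q\<^sup>-\<^sup>s\<close>, as a function of \<open>u = 1/q\<close>.\<close>
definition boole_factor :: "nat \<Rightarrow> complex \<Rightarrow> complex \<Rightarrow> complex" where
  "boole_factor m s u =
     1 - (\<Sum>k<m. euler_poly k 0 * (- s gchoose k) * u ^ k * (1 + (1 + u) powr (- s - of_nat k))) / 2"

text \<open>Trinomial revision turns (-s choose k)(-s-k choose N-k) into (N choose k)(-s choose N).
  With (-s choose N) pulled out, the recurrence for the numbers E_k(0) remains; for N = 0 its value
  2, halved, cancels the constant 1.\<close>

lemma boole_factor_fps:
  obtains F where "boole_factor m s has_fps_expansion F" "\<And>N. N < m \<Longrightarrow> fps_nth F N = 0"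
proof
  define F where "F = 1 - fps_const (1/2) * (\<Sum>k<m. fps_const (euler_poly k 0 * (- s gchoose k)) *
     (fps_X ^ k * (1 + fps_binomial (- s - of_nat k))))"
  have eq: "boole_factor m s = (\<lambda>u. 1 - (1/2) * (\<Sum>k<m. (euler_poly k 0 * (- s gchoose k)) *
     (u ^ k * (1 + (1 + u) powr (- s - of_nat k)))))"
    by (simp add: boole_factor_def fun_eq_iff mult.assoc)
  show "boole_factor m s has_fps_expansion F"
    unfolding eq F_def by (intro fps_expansion_intros)
  fix N assume N: "N < m"
  have "fps_nth (\<Sum>k<m. fps_const (euler_poly k 0 * (- s gchoose k)) *
          (fps_X ^ k * (1 + fps_binomial (- s - of_nat k)))) N =
        (\<Sum>k<m. if k \<le> N then euler_poly k 0 * (- s gchoose k) *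
           ((if N = k then 1 else 0) + ((- s - of_nat k) gchoose (N - k))) else 0)"
    unfolding fps_sum_nth by (intro sum.cong refl) (auto simp: fps_X_power_mult_nth)
  also have "\<dots> = (\<Sum>k\<le>N. euler_poly k 0 * (- s gchoose k) *
           ((if N = k then 1 else 0) + ((- s - of_nat k) gchoose (N - k))))"
    using N by (intro sum.mono_neutral_cong_right) auto
  also have "\<dots> = (\<Sum>k\<le>N. if k = N then euler_poly k 0 * (- s gchoose k) else 0) +
       (\<Sum>k\<le>N. euler_poly k 0 * ((- s gchoose k) * ((- s - of_nat k) gchoose (N - k))))"
    unfolding sum.distrib [symmetric] by (intro sum.cong refl) (auto simp: algebra_simps)
  also have "(\<Sum>k\<le>N. euler_poly k 0 * ((- s gchoose k) * ((- s - of_nat k) gchoose (N - k)))) =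
       (- s gchoose N) * (\<Sum>k\<le>N. of_nat (N choose k) * euler_poly k 0)"
    unfolding sum_distrib_left
    by (intro sum.cong refl)
       (simp add: binomial_gbinomial mult_ac flip: gbinomial_trinomial_revision)
  also have "(\<Sum>k\<le>N. if k = N then euler_poly k 0 * (- s gchoose k) else 0) = (- s gchoose N) * euler_poly N 0"
    by simp
  also have "(- s gchoose N) * euler_poly N 0 + (- s gchoose N) * (\<Sum>k\<le>N. of_nat (N choose k) * euler_poly k 0) =
      (if N = 0 then 2 else 0)"
    unfolding distrib_left [symmetric] euler_poly_0_recurrence by simp
  finally show "fps_nth F N = 0"
    by (simp add: F_def)
qed

section \<open>Estimates of the factor and of the defect, uniform for bounded s\<close>

lemma one_plus_not_nonpos_Real:
  fixes u :: complex
  assumes "norm u < 1"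
  shows "1 + u \<notin> \<real>\<^sub>\<le>\<^sub>0"
  using assms abs_Re_le_cmod[of u] by (auto simp: complex_nonpos_Reals_iff)

text \<open>Compactness bounds the factor uniformly, Cauchy's inequality then bounds its Taylor
  coefficients in u, and the vanishing of the first m of them leaves a factor |u|^m.\<close>

lemma boole_factor_bound:
  assumes "R \<ge> 0"
  obtains B where "\<And>s u. norm s \<le> R \<Longrightarrow> norm u \<le> 1 / 2 \<Longrightarrow> norm (boole_factor m s u) \<le> B * norm u ^ m"
proof -
  \<comment> \<open>The radius 3/4 lies strictly between 1/2, where the bound is wanted, and 1,
    where 1 + u can reach the slit.\<close>
  let ?K = "cball 0 R \<times> cball 0 (3/4) :: (complex \<times> complex) set"
  have "continuous_on ?K (\<lambda>x. boole_factor m (fst x) (snd x))"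
  proof -
    have "Re (1 + u) > 0" if "norm u \<le> 3/4" for u :: complex
      using that abs_Re_le_cmod[of u] by simp
    then have "Re (1 + snd x) > 0" if "x \<in> ?K" for x
      using that by auto
    then show ?thesis
      unfolding boole_factor_def
      by (intro continuous_intros) (fastforce simp: less_imp_le)+
  qed
  then have "compact ((\<lambda>x. boole_factor m (fst x) (snd x)) ` ?K)"
    by (intro compact_continuous_image compact_Times compact_cball)
  then obtain B where B: "\<And>s u. norm s \<le> R \<Longrightarrow> norm u \<le> 3/4 \<Longrightarrow> norm (boole_factor m s u) \<le> B"
    by (force simp: bounded_iff dest!: compact_imp_bounded)
  have B0: "B \<ge> 0"
    using B[of 0 0] assms by (smt (verit) norm_ge_zero norm_zero divide_nonneg_nonneg)
  show thesis
  proof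
    fix s u :: complex
    assume s: "norm s \<le> R" and u: "norm u \<le> 1 / 2"
    obtain F where F: "boole_factor m s has_fps_expansion F" "\<And>N. N < m \<Longrightarrow> fps_nth F N = 0"
      by (rule boole_factor_fps[of m s]) blast
    have hol: "boole_factor m s holomorphic_on ball 0 1"
      unfolding boole_factor_def using one_plus_not_nonpos_Real
      by (intro holomorphic_intros) auto
    have coeff: "norm (fps_nth F N) \<le> B * (4/3) ^ N" for N
    proof -
      have "norm ((deriv ^^ N) (boole_factor m s) 0) \<le> fact N * B / (3/4) ^ N"
      proof (rule Cauchy_inequality)
        show "boole_factor m s holomorphic_on ball 0 (3/4)"
          by (rule holomorphic_on_subset[OF hol]) auto
        show "continuous_on (cball 0 (3/4)) (boole_factor m s)"
          by (rule continuous_on_subset[OF holomorphic_on_imp_continuous_on[OF hol]]) auto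
      qed (use B s in auto)
      then show ?thesis
        by (simp add: fps_nth_fps_expansion[OF F(1)] norm_divide field_simps power_divide)
    qed
    have "(\<lambda>N. fps_nth F N * u ^ N) sums boole_factor m s u"
      by (rule has_fps_expansion_imp_sums_complex[OF F(1), where r = 1]) (use hol u in \<open>auto simp: one_ereal_def\<close>)
    then have sums: "(\<lambda>N. fps_nth F (N + m) * u ^ (N + m)) sums boole_factor m s u"
      using sums_iff_shift[of "\<lambda>N. fps_nth F N * u ^ N" m] F(2) by simp
    \<comment> \<open>The ratio 2/3 is the coefficient growth 4/3 times the bound 1/2 on
      |u|.\<close>
    have geom: "(\<lambda>N. B * (4/3) ^ m * norm u ^ m * (2/3) ^ N) sums (B * (4/3) ^ m * norm u ^ m * (1 / (1 - 2/3)))"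
      by (intro sums_mult geometric_sums) auto
    have "norm (boole_factor m s u) \<le> B * (4/3) ^ m * norm u ^ m * (1 / (1 - 2/3))"
    proof (rule norm_sums_le[OF sums geom])
      fix N
      have "norm (fps_nth F (N + m) * u ^ (N + m)) \<le> B * (4/3) ^ (N + m) * (norm u ^ N * norm u ^ m)"
        using coeff[of "N + m"] by (simp add: norm_mult norm_power mult_right_mono power_add)
      also have "\<dots> \<le> B * (4/3) ^ (N + m) * ((1/2) ^ N * norm u ^ m)"
        using u B0 by (intro mult_left_mono mult_right_mono power_mono) auto
      also have "\<dots> = B * (4/3) ^ m * norm u ^ m * ((4/3) ^ N * (1/2) ^ N)"
        by (simp add: power_add)
      also have "(4/3) ^ N * (1/2) ^ N = (2/3 :: real) ^ N"
        by (simp flip: power_mult_distrib)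
      finally show "norm (fps_nth F (N + m) * u ^ (N + m)) \<le> B * (4/3) ^ m * norm u ^ m * (2/3) ^ N" .
    qed
    then show "norm (boole_factor m s u) \<le> 3 * B * (4/3) ^ m * norm u ^ m"
      by simp
  qed
qed

text \<open>Adding 1 preserves the imaginary part, so the arguments of q and q + 1 lie on the same
  side of 0. Their difference stays in the principal strip, and no multiple of 2 pi i
  appears.\<close>

lemma powr_add_1_factor:
  fixes q :: complex
  assumes "q \<notin> \<real>\<^sub>\<le>\<^sub>0"
  shows "(q + 1) powr a = q powr a * (1 + 1 / q) powr a"
proof -
  have nz: "q \<noteq> 0"
    using assms by auto
  have q1: "q + 1 \<notin> \<real>\<^sub>\<le>\<^sub>0"
    using assms by (auto simp: complex_nonpos_Reals_iff)
  have nz1: "q + 1 \<noteq> 0"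
    using q1 by auto
  have eq: "1 + 1 / q = (q + 1) / q"
    using nz by (simp add: field_simps)
  have "Ln ((q + 1) / q) = Ln (q + 1) - Ln q"
  proof (rule Ln_unique)
    show "exp (Ln (q + 1) - Ln q) = (q + 1) / q"
      using nz nz1 by (simp add: exp_diff)
    have "Im (Ln (q + 1)) < pi" "- pi < Im (Ln (q + 1))" "Im (Ln q) < pi" "- pi < Im (Ln q)"
      using assms q1 nz nz1 by (auto simp: Im_Ln_less_pi mpi_less_Im_Ln)
    moreover have "0 \<le> Im (Ln (q + 1)) \<and> 0 \<le> Im (Ln q) \<or> Im (Ln (q + 1)) < 0 \<and> Im (Ln q) < 0"
    proof (cases "Im q \<ge> 0")
      case True
      then have "Im (q + 1) \<ge> 0" by simp
      with True show ?thesis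
        using Im_Ln_pos_le[OF nz] Im_Ln_pos_le[OF nz1] assms q1 calculation by simp
    next
      case False
      then have "\<not> Im (q + 1) \<ge> 0" by simp
      with False show ?thesis
        using Im_Ln_pos_le[OF nz] Im_Ln_pos_le[OF nz1] calculation by force
    qed
    ultimately show "- pi < Im (Ln (q + 1) - Ln q)" "Im (Ln (q + 1) - Ln q) \<le> pi"
      by auto
  qed
  then have "Ln (q + 1) = Ln q + Ln (1 + 1 / q)"
    by (simp add: eq)
  moreover have "1 + 1 / q \<noteq> 0"
    unfolding eq using nz nz1 by simp
  ultimately show ?thesis
    using nz nz1 by (simp add: powr_def distrib_left exp_add)
qed

lemma boole_defect_eq:
  assumes "q \<notin> \<real>\<^sub>\<le>\<^sub>0"
  shows "boole_defect m s q = q powr (- s) * boole_factor m s (1 / q)"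
proof -
  have nz: "q \<noteq> 0"
    using assms by auto
  have "boole_sum m s q + boole_sum m s (q + 1) = q powr (- s) *
    ((\<Sum>k<m. euler_poly k 0 * (- s gchoose k) * (1 / q) ^ k * (1 + (1 + 1 / q) powr (- s - of_nat k))) / 2)"
    unfolding boole_sum_def add_divide_distrib [symmetric] sum.distrib [symmetric] times_divide_eq_right sum_distrib_left
  proof (intro arg_cong[where f = "\<lambda>x. x / 2"] sum.cong refl)
    fix k
    have "q powr (- s - of_nat k) = q powr (- s) * (1 / q) ^ k"
      using nz by (simp add: powr_diff powr_nat power_divide)
    then show "euler_poly k 0 * (- s gchoose k) * q powr (- s - of_nat k) +
         euler_poly k 0 * (- s gchoose k) * (q + 1) powr (- s - of_nat k) =
         q powr (- s) * (euler_poly k 0 * (- s gchoose k) * (1 / q) ^ k * (1 + (1 + 1 / q) powr (- s - of_nat k)))"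
      unfolding powr_add_1_factor[OF assms] by (simp only: algebra_simps mult_1_left)
  qed
  then show ?thesis
    by (simp add: boole_defect_def boole_factor_def algebra_simps)
qed

lemma norm_powr_le_pi:
  fixes q s :: complex
  assumes "norm q \<ge> 1" "norm s \<le> R"
  shows "norm (q powr s) \<le> norm q powr R * exp (pi * R)"
proof -
  have s: "\<bar>Re s\<bar> \<le> R" "\<bar>Im s\<bar> \<le> R"
    using abs_Re_le_cmod[of s] abs_Im_le_cmod[of s] assms by linarith+
  have "- Im s * Arg q \<le> \<bar>Im s\<bar> * \<bar>Arg q\<bar>"
    by (metis abs_ge_self abs_minus_cancel abs_mult)
  also have "\<dots> \<le> R * pi"
    using s Arg_bounded[of q] by (intro mult_mono) auto
  finally have "exp (- Im s * Arg q) \<le> exp (pi * R)"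
    by (simp add: mult.commute)
  moreover have "norm q powr Re s \<le> norm q powr R"
    using assms s by (intro powr_mono) auto
  ultimately show ?thesis
    unfolding norm_powr_complex by (intro mult_mono) auto
qed

text \<open>Of the R + p powers of 1/|q| supplied by the factor, R compensate the growth of
  \<open>q powr (- s)\<close> for |s| at most R, and p remain.\<close>

lemma boole_defect_bound:
  fixes R p :: nat
  obtains C where "\<And>s q. norm s \<le> R \<Longrightarrow> q \<notin> \<real>\<^sub>\<le>\<^sub>0 \<Longrightarrow> norm q \<ge> 2 \<Longrightarrow>
    norm (boole_defect (R + p) s q) \<le> C / norm q ^ p"
proof -
  obtain B where B: "\<And>s u. norm s \<le> real R \<Longrightarrow> norm u \<le> 1 / 2 \<Longrightarrow> norm (boole_factor (R + p) s u) \<le> B * norm u ^ (R + p)"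
    using boole_factor_bound[of "real R" "R + p"] by auto
  show thesis
  proof
    fix s q :: complex
    assume s: "norm s \<le> R" and q: "q \<notin> \<real>\<^sub>\<le>\<^sub>0" "norm q \<ge> 2"
    have "norm (q powr (- s)) \<le> norm q ^ R * exp (pi * R)"
    proof -
      have "norm q > 0" using q by linarith
      then show ?thesis
        using norm_powr_le_pi[of q "- s" R] s q by (simp add: powr_realpow)
    qed
    moreover have "norm (boole_factor (R + p) s (1 / q)) \<le> B * norm (1 / q) ^ (R + p)"
      using s q by (intro B) (auto simp: norm_divide divide_simps)
    ultimately have "norm (boole_defect (R + p) s q) \<le>
        (norm q ^ R * exp (pi * R)) * (B * norm (1 / q) ^ (R + p))"
      unfolding boole_defect_eq[OF q(1)] norm_mult by (intro mult_mono) auto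
    also have "\<dots> = exp (pi * R) * B / norm q ^ p"
    proof -
      have "norm q > 0" using q by linarith
      then show ?thesis
        by (simp add: norm_divide power_divide power_add field_simps)
    qed
    finally show "norm (boole_defect (R + p) s q) \<le> exp (pi * R) * B / norm q ^ p" .
  qed
qed

subsection \<open>Analytic continuation\<close>

lemma holomorphic_on_boole_sum: "(\<lambda>s. boole_sum m s q) holomorphic_on A"
  unfolding boole_sum_def by (intro holomorphic_intros) auto

lemma holomorphic_on_boole_defect: "(\<lambda>s. boole_defect m s q) holomorphic_on A"
  unfolding boole_defect_def by (intro holomorphic_intros holomorphic_on_boole_sum)

text \<open>The alternating signs make the two Boole sums in each defect telescope, leaving only the
  end terms.\<close>

lemma sum_boole_defect:
  "(\<Sum>j<N. (-1) ^ j * boole_defect m s (q + of_nat j)) =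
     (\<Sum>j<N. (-1) ^ j * (q + of_nat j) powr (- s)) + (-1) ^ N * boole_sum m s (q + of_nat N) - boole_sum m s q"
  by (induction N) (simp_all add: boole_defect_def algebra_simps)

lemma tendsto_powr_shift:
  fixes q w :: complex
  assumes "Re w < 0"
  shows "(\<lambda>N. (q + of_nat N) powr w) \<longlonglongrightarrow> 0"
proof (rule Lim_null_comparison)
  have "filterlim (\<lambda>N. real N - norm q) at_top sequentially"
    using filterlim_tendsto_add_at_top[OF tendsto_const[of "- norm q"] filterlim_real_sequentially]
    by simp
  moreover have "real N - norm q \<le> norm (q + of_nat N)" for N
    using norm_diff_ineq[of "of_nat N :: complex" q] by (simp add: add.commute)
  ultimately have lim: "filterlim (\<lambda>N. norm (q + of_nat N)) at_top sequentially"
    by (elim filterlim_at_top_mono) auto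
  have "(\<lambda>N. norm (q + of_nat N) powr Re w) \<longlonglongrightarrow> 0"
    by (rule tendsto_neg_powr[OF assms lim])
  then show "(\<lambda>N. norm (q + of_nat N) powr Re w * exp (\<bar>Im w\<bar> * pi)) \<longlonglongrightarrow> 0"
    by (rule tendsto_mult_left_zero)
  have "- Im w * Arg x \<le> \<bar>Im w\<bar> * pi" for x
  proof -
    have "- Im w * Arg x \<le> \<bar>Im w\<bar> * \<bar>Arg x\<bar>"
      by (metis abs_ge_self abs_minus_cancel abs_mult)
    also have "\<dots> \<le> \<bar>Im w\<bar> * pi"
      using Arg_bounded[of x] by (intro mult_left_mono) auto
    finally show ?thesis .
  qed
  then show "\<forall>\<^sub>F N in sequentially. norm ((q + of_nat N) powr w) \<le> norm (q + of_nat N) powr Re w * exp (\<bar>Im w\<bar> * pi)"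
    unfolding norm_powr_complex by (intro always_eventually allI mult_left_mono) auto
qed

text \<open>Each term with m \<le> k < m' carries an exponent of negative real part.\<close>

lemma tendsto_boole_sum_diff:
  assumes "Re s + real m > 0" "m \<le> m'"
  shows "(\<lambda>N. (-1) ^ N * boole_sum m' s (q + of_nat N) - (-1) ^ N * boole_sum m s (q + of_nat N)) \<longlonglongrightarrow> 0"
proof -
  have diff: "boole_sum m' s x - boole_sum m s x =
      (\<Sum>k=m..<m'. euler_poly k 0 * (- s gchoose k) * x powr (- s - of_nat k)) / 2" for x
    unfolding boole_sum_def diff_divide_distrib [symmetric] lessThan_atLeast0
    by (simp only: sum_diff_nat_ivl[OF le0 assms(2)])
  have "(\<lambda>N. boole_sum m' s (q + of_nat N) - boole_sum m s (q + of_nat N)) \<longlonglongrightarrow>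
      (\<Sum>k=m..<m'. euler_poly k 0 * (- s gchoose k) * 0) / 2"
    unfolding diff using assms(1) by (intro tendsto_intros tendsto_powr_shift) auto
  then have "(\<lambda>N. norm (boole_sum m' s (q + of_nat N) - boole_sum m s (q + of_nat N))) \<longlonglongrightarrow> 0"
    by (simp add: tendsto_norm_zero_iff)
  then have "(\<lambda>N. norm ((-1) ^ N * boole_sum m' s (q + of_nat N) - (-1) ^ N * boole_sum m s (q + of_nat N))) \<longlonglongrightarrow> 0"
    by (simp add: norm_mult norm_power flip: right_diff_distrib)
  then show ?thesis
    by (rule tendsto_norm_zero_cancel)
qed

text \<open>
  The number of Boole terms in the definition depends on \<open>s\<close>, but the limit does not change when
  more of them are taken: each further term vanishes as \<open>N\<close> tends to infinity.
\<close>
definition alt_hurwitz_cont :: "complex \<Rightarrow> complex \<Rightarrow> complex" where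
  "alt_hurwitz_cont s q = lim (\<lambda>N. (\<Sum>j<N. (-1) ^ j * (q + of_nat j) powr (- s)) +
     (-1) ^ N * boole_sum (nat \<lceil>norm s\<rceil> + 2) s (q + of_nat N))"

text \<open>Isolates what is needed of the sector: the points q + j recede linearly, and c |q| \<ge>
  2 keeps them all in the range of the defect estimate. In the sector, c is sin(\<delta>/2).\<close>

locale shifted_ray =
  fixes c :: real and q :: complex
  assumes c_pos: "c > 0"
    and slit: "q \<notin> \<real>\<^sub>\<le>\<^sub>0"
    and large: "c * norm q \<ge> 2"
    and ray: "norm (q + of_nat j) \<ge> c * (norm q + real j)"
begin

lemma norm_shift_ge_2: "norm (q + of_nat j) \<ge> 2"
proof -
  have "c * (norm q + real j) \<ge> c * norm q"
    using c_pos by simp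
  with large ray[of j] show ?thesis
    by linarith
qed

lemma shift_slit: "q + of_nat j \<notin> \<real>\<^sub>\<le>\<^sub>0"
  using slit by (auto simp: complex_nonpos_Reals_iff)

text \<open>Of the p + 2 powers of |q| + j, p are bounded below by |q| and two by 1 + j. This gives
  decay in q together with summability over j.\<close>

lemma defect_bound:
  assumes bound: "\<And>s q. norm s \<le> R \<Longrightarrow> q \<notin> \<real>\<^sub>\<le>\<^sub>0 \<Longrightarrow> norm q \<ge> 2 \<Longrightarrow>
      norm (boole_defect m s q) \<le> C / norm q ^ (p + 2)"
    and s: "norm s \<le> R"
  shows "norm (boole_defect m s (q + of_nat j)) \<le> C / c ^ (p + 2) / norm q ^ p * (1 / real ((j + 1) ^ 2))"
proof -
  have q: "norm q \<ge> 2"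
    using norm_shift_ge_2[of 0] by simp
  \<comment> \<open>The assumed bound, taken at q itself, forces C to be nonnegative, as the later
    division estimate requires.\<close>
  have "0 \<le> C / norm q ^ (p + 2)"
    using bound[OF s slit q] norm_ge_zero order_trans by blast
  moreover have "norm q ^ (p + 2) > 0"
    using q by (intro zero_less_power) auto
  ultimately have C: "C \<ge> 0"
    by (simp add: zero_le_divide_iff)
  have "(c * (norm q + real j)) ^ (p + 2) = c ^ (p + 2) * ((norm q + real j) ^ p * (norm q + real j) ^ 2)"
    by (simp only: power_mult_distrib power_add mult_ac)
  moreover have "norm q ^ p * (1 + real j) ^ 2 \<le> (norm q + real j) ^ p * (norm q + real j) ^ 2"
    using q by (intro mult_mono power_mono) auto
  ultimately have "c ^ (p + 2) * (norm q ^ p * (1 + real j) ^ 2) \<le> (c * (norm q + real j)) ^ (p + 2)"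
    using c_pos by simp
  also have "\<dots> \<le> norm (q + of_nat j) ^ (p + 2)"
    using ray[of j] c_pos by (intro power_mono) auto
  finally have "c ^ (p + 2) * (norm q ^ p * (1 + real j) ^ 2) \<le> norm (q + of_nat j) ^ (p + 2)" .
  moreover have "norm (q + of_nat j) > 0" "norm q > 0"
    using norm_shift_ge_2[of j] q by linarith+
  ultimately have "C / norm (q + of_nat j) ^ (p + 2) \<le> C / (c ^ (p + 2) * (norm q ^ p * (1 + real j) ^ 2))"
    using C c_pos by (intro divide_left_mono mult_pos_pos zero_less_power) auto
  also have "\<dots> = C / c ^ (p + 2) / norm q ^ p * (1 / real ((j + 1) ^ 2))"
    by (simp add: field_simps)
  finally show ?thesis
    using bound[OF s shift_slit norm_shift_ge_2, of j] by linarith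
qed

text \<open>The case p = 0: a majorant independent of s, serving both convergence and the
  Weierstrass M-test.\<close>

lemma defect_bound_summable:
  fixes R :: nat
  obtains D where "\<And>s j. norm s \<le> R \<Longrightarrow>
    norm ((-1) ^ j * boole_defect (R + 2) s (q + of_nat j)) \<le> D * (1 / real ((j + 1) ^ 2))"
    "summable (\<lambda>j. D * (1 / real ((j + 1) ^ 2)))"
proof -
  obtain C where C: "\<And>s q. norm s \<le> R \<Longrightarrow> q \<notin> \<real>\<^sub>\<le>\<^sub>0 \<Longrightarrow> norm q \<ge> 2 \<Longrightarrow>
      norm (boole_defect (R + 2) s q) \<le> C / norm q ^ 2"
    using boole_defect_bound[of R 2] by metis
  show thesis
  proof (rule that)
    fix s :: complex and j :: nat
    assume "norm s \<le> real R"
    then have "norm (boole_defect (R + 2) s (q + of_nat j)) \<le> C / c ^ (0 + 2) / norm q ^ 0 * (1 / real ((j + 1) ^ 2))"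
      by (intro defect_bound) (use C in \<open>simp_all only: add_0\<close>)
    then show "norm ((-1) ^ j * boole_defect (R + 2) s (q + of_nat j)) \<le>
        C / c ^ (0 + 2) / norm q ^ 0 * (1 / real ((j + 1) ^ 2))"
      by (simp only: norm_mult norm_power norm_minus_cancel norm_one power_one mult_1_left)
  next
    show "summable (\<lambda>j. C / c ^ (0 + 2) / norm q ^ 0 * (1 / real ((j + 1) ^ 2)))"
      using inverse_squares_sums by (intro summable_mult) (simp add: sums_iff)
  qed
qed

text \<open>With R + 2 Boole terms the limit exists because the telescoped defect series converges
  absolutely; changing to m terms adds a null sequence.\<close>

lemma alt_hurwitz_cont_tendsto:
  assumes "Re s + real m > 0"
  shows "(\<lambda>N. (\<Sum>j<N. (-1) ^ j * (q + of_nat j) powr (- s)) + (-1) ^ N * boole_sum m s (q + of_nat N))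
           \<longlonglongrightarrow> alt_hurwitz_cont s q"
proof -
  define R where "R = nat \<lceil>norm s\<rceil>"
  let ?f = "\<lambda>m N. (\<Sum>j<N. (-1) ^ j * (q + of_nat j) powr (- s)) + (-1) ^ N * boole_sum m s (q + of_nat N)"
  have s: "norm s \<le> R"
    by (simp add: R_def of_nat_ceiling)
  obtain D where D: "\<And>j. norm ((-1) ^ j * boole_defect (R + 2) s (q + of_nat j)) \<le> D * (1 / real ((j + 1) ^ 2))"
    "summable (\<lambda>j. D * (1 / real ((j + 1) ^ 2)))"
    using defect_bound_summable[of R] s by metis
  have "summable (\<lambda>j. (-1) ^ j * boole_defect (R + 2) s (q + of_nat j))"
    by (rule summable_comparison_test'[OF D(2) D(1)])
  then have "convergent (\<lambda>N. (\<Sum>j<N. (-1) ^ j * boole_defect (R + 2) s (q + of_nat j)) + boole_sum (R + 2) s q)"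
    by (intro convergent_add convergent_const) (simp add: summable_iff_convergent)
  then have "convergent (?f (R + 2))"
    by (simp add: sum_boole_defect)
  then have lim: "?f (R + 2) \<longlonglongrightarrow> alt_hurwitz_cont s q"
    unfolding alt_hurwitz_cont_def R_def by (rule convergent_LIMSEQ_iff[THEN iffD1])
  \<comment> \<open>As m may lie on either side of R + 2, both are compared with their
    maximum.\<close>
  let ?M = "max m (R + 2)"
  have "Re s + real (R + 2) > 0"
    using s abs_Re_le_cmod[of s] by simp
  then have "(\<lambda>N. ?f (R + 2) N + ((-1) ^ N * boole_sum ?M s (q + of_nat N) - (-1) ^ N * boole_sum (R + 2) s (q + of_nat N))
      - ((-1) ^ N * boole_sum ?M s (q + of_nat N) - (-1) ^ N * boole_sum m s (q + of_nat N)))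
      \<longlonglongrightarrow> alt_hurwitz_cont s q + 0 - 0"
    by (intro tendsto_diff tendsto_add lim tendsto_boole_sum_diff assms) auto
  then show ?thesis
    by simp
qed

lemma boole_defect_sums:
  assumes "Re s + real m > 0"
  shows "(\<lambda>j. (-1) ^ j * boole_defect m s (q + of_nat j)) sums (alt_hurwitz_cont s q - boole_sum m s q)"
  unfolding sums_def sum_boole_defect
  by (intro tendsto_diff tendsto_const alt_hurwitz_cont_tendsto assms)

text \<open>On the disc of radius R the fixed number R + 2 of Boole terms serves all s, so the
  defect series is a uniform limit of entire functions there. These discs exhaust the plane.\<close>

lemma holomorphic_on_alt_hurwitz_cont: "(\<lambda>s. alt_hurwitz_cont s q) holomorphic_on UNIV"
proof -
  have hol: "(\<lambda>s. alt_hurwitz_cont s q) holomorphic_on ball 0 (real R)" for R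
  proof -
    obtain D where D: "\<And>s j. norm s \<le> R \<Longrightarrow>
        norm ((-1) ^ j * boole_defect (R + 2) s (q + of_nat j)) \<le> D * (1 / real ((j + 1) ^ 2))"
      "summable (\<lambda>j. D * (1 / real ((j + 1) ^ 2)))"
      by (rule defect_bound_summable[of R]) blast
    let ?g = "\<lambda>s. \<Sum>j. (-1) ^ j * boole_defect (R + 2) s (q + of_nat j)"
    have unif: "uniform_limit (cball 0 (real R)) (\<lambda>N s. \<Sum>j<N. (-1) ^ j * boole_defect (R + 2) s (q + of_nat j)) ?g sequentially"
      by (rule Weierstrass_m_test[OF _ D(2)]) (use D(1) in auto)
    have "?g holomorphic_on ball 0 (real R)"
    proof (rule holomorphic_uniform_sequence)
      show "(\<lambda>s. \<Sum>j<N. (-1) ^ j * boole_defect (R + 2) s (q + of_nat j)) holomorphic_on ball 0 (real R)" for N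
        by (intro holomorphic_intros holomorphic_on_boole_defect)
      fix x :: complex
      assume "x \<in> ball 0 (real R)"
      then obtain d where d: "d > 0" "cball x d \<subseteq> ball 0 (real R)"
        using open_ball open_contains_cball by metis
      moreover have "uniform_limit (cball x d) (\<lambda>N s. \<Sum>j<N. (-1) ^ j * boole_defect (R + 2) s (q + of_nat j)) ?g sequentially"
        using d(2) ball_subset_cball by (intro uniform_limit_on_subset[OF unif]) blast
      ultimately show "\<exists>d>0. cball x d \<subseteq> ball 0 (real R) \<and>
          uniform_limit (cball x d) (\<lambda>N s. \<Sum>j<N. (-1) ^ j * boole_defect (R + 2) s (q + of_nat j)) ?g sequentially"
        by blast
    qed auto
    then have "(\<lambda>s. ?g s + boole_sum (R + 2) s q) holomorphic_on ball 0 (real R)"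
      by (intro holomorphic_intros holomorphic_on_boole_sum)
    moreover have "?g s + boole_sum (R + 2) s q = alt_hurwitz_cont s q" if "s \<in> ball 0 (real R)" for s
    proof -
      have "Re s + real (R + 2) > 0"
        using that abs_Re_le_cmod[of s] by simp
      from boole_defect_sums[OF this] show ?thesis
        by (simp add: sums_iff)
    qed
    ultimately show ?thesis
      by (rule holomorphic_transform)
  qed
  have "(\<lambda>s. alt_hurwitz_cont s q) field_differentiable at z" for z
  proof -
    obtain R :: nat where "norm z < real R"
      using reals_Archimedean2 by blast
    then show ?thesis
      using hol[of R] by (intro holomorphic_on_imp_differentiable_at[of _ "ball 0 (real R)"]) auto
  qed
  then show ?thesis
    by (simp add: holomorphic_on_def field_differentiable_at_within)
qed

lemma alt_hurwitz_zeta_eq_cont: "alt_hurwitz_zeta s q = alt_hurwitz_cont s q"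
proof -
  have sums: "(\<lambda>n. (-1) ^ n / (of_nat n + q) powr z) sums alt_hurwitz_cont z q" if "Re z > 0" for z
    \<comment> \<open>For m = 0 the Boole correction is an empty sum, and the limit is that of the
      original series.\<close>
    using alt_hurwitz_cont_tendsto[of z 0] that
    by (simp add: sums_def boole_sum_def powr_minus_divide add.commute)
  have "(THE f. f holomorphic_on UNIV \<and>
        (\<forall>z. Re z > 0 \<longrightarrow> (\<lambda>n. (-1) ^ n / (of_nat n + q) powr z) sums f z)) = (\<lambda>s. alt_hurwitz_cont s q)"
  proof (rule the_equality)
    fix f
    assume f: "f holomorphic_on UNIV \<and> (\<forall>z. Re z > 0 \<longrightarrow> (\<lambda>n. (-1) ^ n / (of_nat n + q) powr z) sums f z)"
    show "f = (\<lambda>s. alt_hurwitz_cont s q)"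
    proof
      fix s
      show "f s = alt_hurwitz_cont s q"
      proof (rule analytic_continuation_open[of "{z. Re z > 0}" UNIV f "\<lambda>s. alt_hurwitz_cont s q"])
        show "open {z. Re z > 0}"
          by (rule open_halfspace_Re_gt)
        show "{z. Re z > 0} \<noteq> {}"
          by (auto intro!: exI[of _ 1])
        show "f z = alt_hurwitz_cont z q" if "z \<in> {z. Re z > 0}" for z
          using that f sums[of z] sums_unique2 by blast
      qed (use f holomorphic_on_alt_hurwitz_cont in auto)
    qed
  qed (use sums holomorphic_on_alt_hurwitz_cont in auto)
  then show ?thesis
    by (simp add: alt_hurwitz_zeta_def)
qed

text \<open>Cauchy's inequality on the unit circle about z, which lies in |s| \<le> R; there R < m
  makes the defect series converge. The constant pi^2/6 is the sum of 1/(j+1)^2.\<close>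

lemma deriv_alt_hurwitz_zeta_bound:
  assumes bound: "\<And>s q. norm s \<le> R \<Longrightarrow> q \<notin> \<real>\<^sub>\<le>\<^sub>0 \<Longrightarrow> norm q \<ge> 2 \<Longrightarrow>
      norm (boole_defect m s q) \<le> C / norm q ^ (p + 2)"
    and "norm z + 1 \<le> R" "R < real m"
  shows "norm (deriv (\<lambda>s. alt_hurwitz_zeta s q) z - deriv (\<lambda>s. boole_sum m s q) z) \<le>
           C / c ^ (p + 2) / norm q ^ p * (pi\<^sup>2 / 6)"
proof -
  let ?f = "\<lambda>s. alt_hurwitz_cont s q - boole_sum m s q"
  have hol: "?f holomorphic_on A" for A
    by (intro holomorphic_intros holomorphic_on_boole_sum
        holomorphic_on_subset[OF holomorphic_on_alt_hurwitz_cont]) auto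
  have "norm ((deriv ^^ 1) ?f z) \<le> fact 1 * (C / c ^ (p + 2) / norm q ^ p * (pi\<^sup>2 / 6)) / 1 ^ 1"
  proof (rule Cauchy_inequality)
    show "continuous_on (cball z 1) ?f"
      by (rule holomorphic_on_imp_continuous_on[OF hol])
    fix s
    assume "norm (z - s) = 1"
    then have s: "norm s \<le> R"
      using assms(2) norm_triangle_ineq2[of s z] by (simp add: norm_minus_commute)
    have "Re s + real m > 0"
      using s assms(3) abs_Re_le_cmod[of s] by linarith
    then show "norm (?f s) \<le> C / c ^ (p + 2) / norm q ^ p * (pi\<^sup>2 / 6)"
    proof (rule norm_sums_le[OF boole_defect_sums])
      show "(\<lambda>j. C / c ^ (p + 2) / norm q ^ p * (1 / real ((j + 1) ^ 2))) sums
          (C / c ^ (p + 2) / norm q ^ p * (pi\<^sup>2 / 6))"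
        using inverse_squares_sums by (intro sums_mult) simp
    qed (use defect_bound[OF bound s] in \<open>simp add: norm_mult norm_power\<close>)
  qed (use hol in auto)
  moreover have "deriv ?f z = deriv (\<lambda>s. alt_hurwitz_cont s q) z - deriv (\<lambda>s. boole_sum m s q) z"
    by (intro deriv_diff holomorphic_on_imp_differentiable_at[of _ UNIV]
        holomorphic_on_boole_sum holomorphic_on_alt_hurwitz_cont) auto
  ultimately show ?thesis
    by (simp add: alt_hurwitz_zeta_eq_cont)
qed

end

subsection \<open>The expansion of the derivative\<close>

text \<open>Product rule: the derivative of the binomial gives the sum over j, that of the power
  gives the logarithm. Both minus signs come from differentiating -s.\<close>

lemma has_field_derivative_boole_term:
  fixes q :: complex
  assumes "q \<noteq> 0"
  shows "((\<lambda>s. (- s gchoose k) * q powr (- s - of_nat k)) has_field_derivative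
     - (\<Sum>j<k. of_nat (n choose j) * ((-1) ^ (k - j - 1) / of_nat (k - j))) * q powi (int n - int k)
     - of_nat (n choose k) * q powi (int n - int k) * Ln q) (at (- of_nat n))"
proof -
  have powi: "q powr (of_nat n - of_nat k) = q powi (int n - int k)"
    using assms complex_powr_of_int[of q "int n - int k"] by simp
  have neg: "(uminus has_field_derivative -1) (at (- of_nat n :: complex))"
    by (auto intro!: derivative_eq_intros)
  have "((\<lambda>s. - s gchoose k) has_field_derivative
      - (\<Sum>j<k. of_nat (n choose j) * ((-1) ^ (k - j - 1) / of_nat (k - j)))) (at (- of_nat n :: complex))"
    using DERIV_chain'[OF neg, of "\<lambda>w. w gchoose k"] has_field_derivative_gbinomial_of_nat[of k n]
    by simp
  moreover have "((\<lambda>s. q powr (- s - of_nat k)) has_field_derivative - (q powi (int n - int k) * Ln q))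
      (at (- of_nat n))"
  proof -
    have "((\<lambda>s. - s - of_nat k) has_field_derivative -1) (at (- of_nat n :: complex))"
      by (auto intro!: derivative_eq_intros)
    from DERIV_chain'[OF this has_field_derivative_powr_right[OF assms]]
    show ?thesis
      by (simp add: powi mult.commute)
  qed
  ultimately show ?thesis
    by (rule DERIV_cong[OF DERIV_mult]) (simp add: powi algebra_simps binomial_gbinomial)
qed

lemma sum_odd_only:
  fixes f :: "nat \<Rightarrow> 'a::comm_monoid_add"
  assumes "\<And>i. f (2 * i) = 0"
  shows "(\<Sum>k<2 * L + 2. f k) = f 1 + (\<Sum>k=1..L. f (2 * k + 1))"
proof (induction L)
  case 0
  show ?case
    using assms[of 0] by (simp add: numeral_2_eq_2)
next
  case (Suc L)
  have "(\<Sum>k<2 * Suc L + 2. f k) = (\<Sum>k<2 * L + 2. f k) + f (2 * Suc L) + f (2 * Suc L + 1)"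
    by (simp add: add.assoc)
  then show ?case
    using Suc assms[of "Suc L"] by (simp add: add.assoc)
qed

text \<open>The sign simplifies because 2k - j and j have the same parity; the range shrinks because
  (n choose j) = 0 for j > n.\<close>

lemma sum_binomial_odd:
  "(\<Sum>j<2 * k + 1. of_nat (n choose j) * ((-1) ^ (2 * k + 1 - j - 1) / of_nat (2 * k + 1 - j))) =
   (\<Sum>j=0..min n (2 * k). of_nat (n choose j) * ((-1) ^ j / (2 * of_nat k - of_nat j + 1 :: complex)))"
proof (rule sum.mono_neutral_cong_right)
  fix j
  assume "j \<in> {0..min n (2 * k)}"
  then have j: "j \<le> 2 * k"
    by simp
  then obtain i where i: "2 * k = j + i"
    using le_Suc_ex by blast
  then have "even i \<longleftrightarrow> even j" and "2 * k + 1 - j - 1 = i"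
    by presburger+
  then have "(-1) ^ (2 * k + 1 - j - 1) = ((-1) ^ j :: complex)"
    by (simp only: minus_one_power_iff)
  moreover have "of_nat (2 * k + 1 - j) = (2 * of_nat k - of_nat j + 1 :: complex)"
    using j by (simp add: of_nat_diff)
  ultimately show "of_nat (n choose j) * ((-1) ^ (2 * k + 1 - j - 1) / of_nat (2 * k + 1 - j)) =
      of_nat (n choose j) * ((-1) ^ j / (2 * of_nat k - of_nat j + 1 :: complex))"
    by (simp only:)
next
  show "\<forall>j\<in>{..<2 * k + 1} - {0..min n (2 * k)}.
      of_nat (n choose j) * ((-1) ^ (2 * k + 1 - j - 1) / of_nat (2 * k + 1 - j)) = (0 :: complex)"
  proof
    fix j
    assume "j \<in> {..<2 * k + 1} - {0..min n (2 * k)}"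
    then have "n < j"
      by auto
    then show "of_nat (n choose j) * ((-1) ^ (2 * k + 1 - j - 1) / of_nat (2 * k + 1 - j)) = (0 :: complex)"
      by (simp add: binomial_eq_0)
  qed
  show "{0..min n (2 * k)} \<subseteq> {..<2 * k + 1}"
    by (simp add: subset_iff)
qed simp

text \<open>Since n < 2L + 2, all k \<le> n are in range and the logarithmic coefficients assemble
  to the complete E_n(q). In the other part only odd k survive: k = 1 yields the term with 1/4, the
  rest form the sum.\<close>

lemma deriv_boole_sum:
  fixes q :: complex
  assumes "q \<noteq> 0" "n < 2 * L + 2"
  shows "deriv (\<lambda>s. boole_sum (2 * L + 2) s q) (- of_nat n) =
    1/4 * q powi (int n - 1) - 1/2 * euler_poly n q * Ln q
     - 1/2 * (\<Sum>k=1..L. euler_poly (2*k+1) 0 *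
         (\<Sum>j=0..min n (2*k).
            of_nat (n choose j) * ((-1) ^ j / (2 * of_nat k - of_nat j + 1))) *
         q powi (int n - 2 * int k - 1))"
proof -
  define G where "G k = (\<Sum>j<k. of_nat (n choose j) * ((-1) ^ (k - j - 1) / of_nat (k - j)) :: complex)" for k
  have split: "(\<Sum>k\<in>A. e k * (- g k * x k - b k * x k * l)) / 2 =
      - 1/2 * (\<Sum>k\<in>A. e k * g k * x k) - 1/2 * (\<Sum>k\<in>A. b k * e k * x k) * l"
    for A :: "nat set" and e g x b :: "nat \<Rightarrow> complex" and l :: complex
    by (simp add: right_diff_distrib sum_subtractf sum_distrib_left sum_distrib_right diff_divide_distrib
        sum_divide_distrib sum_negf mult_ac)
  have "((\<lambda>s. (\<Sum>k<2 * L + 2. euler_poly k 0 * ((- s gchoose k) * q powr (- s - of_nat k))) / 2)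
      has_field_derivative (\<Sum>k<2 * L + 2. euler_poly k 0 * (- G k * q powi (int n - int k)
     - of_nat (n choose k) * q powi (int n - int k) * Ln q)) / 2) (at (- of_nat n))"
    unfolding G_def by (intro DERIV_cdivide DERIV_sum DERIV_cmult has_field_derivative_boole_term assms)
  then have "deriv (\<lambda>s. boole_sum (2 * L + 2) s q) (- of_nat n) =
      (\<Sum>k<2 * L + 2. euler_poly k 0 * (- G k * q powi (int n - int k)
     - of_nat (n choose k) * q powi (int n - int k) * Ln q)) / 2"
    unfolding boole_sum_def mult.assoc by (rule DERIV_imp_deriv)
  also have "\<dots> = - 1/2 * (\<Sum>k<2 * L + 2. euler_poly k 0 * G k * q powi (int n - int k))
      - 1/2 * (\<Sum>k<2 * L + 2. of_nat (n choose k) * euler_poly k 0 * q powi (int n - int k)) * Ln q"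
    by (rule split)
  also have "(\<Sum>k<2 * L + 2. of_nat (n choose k) * euler_poly k 0 * q powi (int n - int k)) = euler_poly n q"
    unfolding euler_poly_expand[of n q]
  proof (rule sum.mono_neutral_cong_right)
    show "of_nat (n choose k) * euler_poly k 0 * q powi (int n - int k) =
        of_nat (n choose k) * euler_poly k 0 * q ^ (n - k)" if "k \<in> {..n}" for k
    proof -
      have "int n - int k = int (n - k)"
        using that by (simp add: of_nat_diff)
      then show ?thesis
        by (simp only: power_int_of_nat)
    qed
  qed (use assms(2) in \<open>auto simp: binomial_eq_0\<close>)
  also have "(\<Sum>k<2 * L + 2. euler_poly k 0 * G k * q powi (int n - int k)) =
      euler_poly 1 0 * G 1 * q powi (int n - int 1) +
      (\<Sum>k=1..L. euler_poly (2 * k + 1) 0 * G (2 * k + 1) * q powi (int n - int (2 * k + 1)))"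
  proof (rule sum_odd_only)
    show "euler_poly (2 * i) 0 * G (2 * i) * q powi (int n - int (2 * i)) = 0" for i
      \<comment> \<open>Index 0 is special: E_0(0) = 1, and the term vanishes because
        \<open>G 0\<close> is an empty sum.\<close>
      using euler_poly_0_even[of i] by (cases "i = 0") (auto simp: G_def)
  qed
  also have "\<dots> = - 1/2 * q powi (int n - 1) + (\<Sum>k=1..L. euler_poly (2*k+1) 0 *
         (\<Sum>j=0..min n (2*k).
            of_nat (n choose j) * ((-1) ^ j / (2 * of_nat k - of_nat j + 1))) *
         q powi (int n - 2 * int k - 1))" (is "_ = _ + ?S")
  proof (intro arg_cong2[where f = "(+)"] sum.cong refl)
    show "euler_poly 1 0 * G 1 * q powi (int n - int 1) = - 1/2 * q powi (int n - 1)"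
      by (simp add: G_def euler_poly_0_values)
    have "int n - int (2 * k + 1) = int n - 2 * int k - 1" for k
      by simp
    then show "euler_poly (2 * k + 1) 0 * G (2 * k + 1) * q powi (int n - int (2 * k + 1)) =
        euler_poly (2 * k + 1) 0 *
         (\<Sum>j=0..min n (2*k). of_nat (n choose j) * ((-1) ^ j / (2 * of_nat k - of_nat j + 1))) *
         q powi (int n - 2 * int k - 1)" for k
      by (simp only: G_def sum_binomial_odd)
  qed
  also have "- 1/2 * (- 1/2 * q powi (int n - 1) + ?S) - 1/2 * euler_poly n q * Ln q =
      1/4 * q powi (int n - 1) - 1/2 * euler_poly n q * Ln q - 1/2 * ?S"
    by (simp only: distrib_left) simp
  finally show ?thesis .
qed

section \<open>Geometry and growth comparison in the sector\<close>

text \<open>In the sector Re q \<ge> -|q| cos \<delta>. Hence |q + t|^2 exceeds the square of the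
  left side by at least cos(\<delta>/2)^2 (|q| - t)^2.\<close>

lemma sector_ray:
  assumes q: "q \<in> arg_sector \<delta>" and "\<delta> > 0" and "t \<ge> 0"
  shows "sin (\<delta> / 2) * (norm q + t) \<le> norm (q + of_real t)"
proof -
  \<comment> \<open>The existence of a point in the sector forces \<delta> \<le> pi, as |Arg q| is
    nonnegative.\<close>
  have \<delta>: "\<delta> \<le> pi" "\<bar>Arg q\<bar> \<le> pi - \<delta>"
    using q by (auto simp: arg_sector_def)
  have "cos (pi - \<delta>) \<le> cos \<bar>Arg q\<bar>"
    using \<delta> assms(2) by (intro cos_monotone_0_pi_le) auto
  then have "- cos \<delta> \<le> cos (Arg q)"
    by (simp add: cos_diff)
  then have "norm q * (- cos \<delta>) \<le> norm q * cos (Arg q)"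
    by (intro mult_left_mono) auto
  also have "norm q * cos (Arg q) = Re q"
    by (metis Re_rcis rcis_cmod_Arg)
  finally have Re: "- (norm q * cos \<delta>) \<le> Re q"
    by simp
  have cos: "cos \<delta> = 1 - 2 * (sin (\<delta> / 2))\<^sup>2"
    using cos_double_sin[of "\<delta> / 2"] by simp
  have "(sin (\<delta> / 2))\<^sup>2 \<le> 1"
    using sin_cos_squared_add[of "\<delta> / 2"] zero_le_power2[of "cos (\<delta> / 2)"] by linarith
  then have "0 \<le> (1 - (sin (\<delta> / 2))\<^sup>2) * (norm q - t)\<^sup>2"
    by simp
  then have "(sin (\<delta> / 2) * (norm q + t))\<^sup>2 \<le> (norm q)\<^sup>2 - 2 * (norm q * cos \<delta>) * t + t\<^sup>2"
    unfolding cos by (simp add: power2_eq_square algebra_simps)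
  also have "\<dots> \<le> (norm q)\<^sup>2 + 2 * Re q * t + t\<^sup>2"
    using mult_right_mono[OF Re \<open>t \<ge> 0\<close>] by (simp add: mult_ac)
  also have "\<dots> = (norm (q + of_real t))\<^sup>2"
    by (simp only: cmod_power2) (simp add: power2_eq_square algebra_simps)
  finally show ?thesis
    by (rule power2_le_imp_le) simp
qed

lemma shifted_ray_sector:
  assumes q: "q \<in> arg_sector \<delta>" and \<delta>: "\<delta> > 0" and large: "norm q \<ge> 2 / sin (\<delta> / 2)"
  shows "shifted_ray (sin (\<delta> / 2)) q"
proof
  have "\<delta> \<le> pi"
    using q by (auto simp: arg_sector_def)
  then show pos: "sin (\<delta> / 2) > 0"
    using \<delta> by (intro sin_gt_zero) auto
  show "sin (\<delta> / 2) * norm q \<ge> 2"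
    using large pos by (simp add: field_simps)
  have "Arg q \<noteq> pi" and nz: "q \<noteq> 0"
    using q \<delta> by (auto simp: arg_sector_def)
  then have "\<not> (Re q < 0 \<and> Im q = 0)"
    using Arg_eq_pi[of q] by blast
  moreover have "\<not> (Re q = 0 \<and> Im q = 0)"
    using nz by (simp add: complex_eq_iff)
  ultimately show "q \<notin> \<real>\<^sub>\<le>\<^sub>0"
    unfolding complex_nonpos_Reals_iff by linarith
  show "sin (\<delta> / 2) * (norm q + real j) \<le> norm (q + of_nat j)" for j
    using sector_ray[OF q \<delta>, of "real j"] by simp
qed

lemma bigo_powi_sector:
  assumes "k \<le> l"
  shows "(\<lambda>q::complex. a * q powi k) \<in> O[inf at_infinity (principal S)](\<lambda>q. of_real (norm q powi l))"
proof (rule bigoI)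
  have "\<forall>\<^sub>F q::complex in at_infinity. norm q \<ge> 1"
    by (auto simp: eventually_at_infinity)
  then show "\<forall>\<^sub>F q::complex in inf at_infinity (principal S).
      norm (a * q powi k) \<le> norm a * norm (of_real (norm q powi l) :: complex)"
    unfolding eventually_inf_principal
  proof eventually_elim
    case (elim q)
    then have "norm q powi k \<le> norm q powi l"
      using assms by (intro power_int_increasing) auto
    then show ?case
      by (auto simp: norm_mult norm_power_int intro: mult_left_mono)
  qed
qed

theorem corollary3p10:
  fixes n :: nat and \<delta> :: real
  assumes "\<delta> > 0"
  shows "\<forall>K::nat.
    (\<lambda>q::complex.
        deriv (\<lambda>s. alt_hurwitz_zeta s q) (- of_nat n) -
        (1/4 * q powi (int n - 1) - 1/2 * euler_poly n q * Ln q
         - 1/2 * (\<Sum>k=1..K. euler_poly (2*k+1) 0 *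
             (\<Sum>j=0..min n (2*k).
                of_nat (n choose j) * ((-1) ^ j / (2 * of_nat k - of_nat j + 1))) *
             q powi (int n - 2 * int k - 1))))
    \<in> O[inf at_infinity (principal (arg_sector \<delta>))](\<lambda>q. of_real (norm q powi (int n - 2 * int K - 3)))"
proof
  fix K :: nat
  define F where "F = inf at_infinity (principal (arg_sector \<delta>))"
  \<comment> \<open>The decay exponent satisfies -p \<le> n - 2K - 3, and L makes 2L + 2 = (n + 1) +
    (p + 2). Here n + 1 bounds |s| on the unit disc about -n, and the extra 2 pays for the summation
    over j.\<close>
  define L where "L = n + K + 2"
  define p where "p = n + 2 * K + 3"
  define c where "c = sin (\<delta> / 2)"
  define a where "a k = euler_poly (2*k+1) 0 *
     (\<Sum>j=0..min n (2*k). of_nat (n choose j) * ((-1) ^ j / (2 * of_nat k - of_nat j + 1)))" for k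
  define h where "h q = (of_real (norm q powi (int n - 2 * int K - 3)) :: complex)" for q :: complex
  let ?err = "\<lambda>q. deriv (\<lambda>s. alt_hurwitz_zeta s q) (- of_nat n) - deriv (\<lambda>s. boole_sum (2 * L + 2) s q) (- of_nat n)"
  define D where "D = (\<lambda>C. C / c ^ (p + 2) * (pi\<^sup>2 / 6))"
  have m: "n + 1 + (p + 2) = 2 * L + 2"
    by (simp add: L_def p_def)
  obtain C where C: "\<And>s q. norm s \<le> real (n + 1) \<Longrightarrow> q \<notin> \<real>\<^sub>\<le>\<^sub>0 \<Longrightarrow> norm q \<ge> 2 \<Longrightarrow>
      norm (boole_defect (2 * L + 2) s q) \<le> C / norm q ^ (p + 2)"
    using boole_defect_bound[of "n + 1" "p + 2"] unfolding m by metis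
  have err: "?err \<in> O[F](h)"
  proof (rule bigoI)
    \<comment> \<open>The bound 2/c puts q in the range of \<open>shifted_ray\<close>; the bound 1
      allows powers of |q| to be compared by exponent.\<close>
    have "\<forall>\<^sub>F q::complex in at_infinity. norm q \<ge> 2 / c \<and> norm q \<ge> 1"
      unfolding eventually_at_infinity by (intro exI[of _ "max (2 / c) 1"]) auto
    then show "\<forall>\<^sub>F q in F. norm (?err q) \<le> \<bar>D C\<bar> * norm (h q)"
      unfolding eventually_inf_principal F_def
    proof (eventually_elim, intro impI)
      fix q :: complex
      assume big: "norm q \<ge> 2 / c \<and> norm q \<ge> 1" and q: "q \<in> arg_sector \<delta>"
      then interpret shifted_ray c q
        using assms unfolding c_def by (intro shifted_ray_sector) auto
      have "norm (?err q) \<le> C / c ^ (p + 2) / norm q ^ p * (pi\<^sup>2 / 6)"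
        by (rule deriv_alt_hurwitz_zeta_bound[OF C]) (auto simp: L_def)
      also have "\<dots> = D C * norm q powi (- int p)"
        by (simp add: D_def power_int_minus field_simps)
      also have "\<dots> \<le> \<bar>D C\<bar> * norm q powi (int n - 2 * int K - 3)"
        using big by (intro mult_mono power_int_increasing) (auto simp: p_def)
      finally show "norm (?err q) \<le> \<bar>D C\<bar> * norm (h q)"
        by (simp add: h_def norm_power_int)
    qed
  qed
  have "(\<lambda>q. - 1/2 * (\<Sum>k=K+1..L. a k * q powi (int n - 2 * int k - 1))) \<in> O[F](h)"
    unfolding F_def h_def sum_distrib_left mult.assoc [symmetric]
    by (intro big_sum_in_bigo bigo_powi_sector) auto
  from sum_in_bigo(1)[OF err this]
  have "(\<lambda>q. ?err q + - 1/2 * (\<Sum>k=K+1..L. a k * q powi (int n - 2 * int k - 1))) \<in> O[F](h)" .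
  also have "?this \<longleftrightarrow> (\<lambda>q. deriv (\<lambda>s. alt_hurwitz_zeta s q) (- of_nat n) -
        (1/4 * q powi (int n - 1) - 1/2 * euler_poly n q * Ln q
         - 1/2 * (\<Sum>k=1..K. a k * q powi (int n - 2 * int k - 1)))) \<in> O[F](h)"
  \<comment> \<open>The two functions are compared on the sector only, where q is nonzero; the
    filter sees no other points.\<close>
  proof (rule landau_o.big.in_cong)
    have "?err q + - 1/2 * (\<Sum>k=K+1..L. a k * q powi (int n - 2 * int k - 1)) =
       deriv (\<lambda>s. alt_hurwitz_zeta s q) (- of_nat n) -
        (1/4 * q powi (int n - 1) - 1/2 * euler_poly n q * Ln q
         - 1/2 * (\<Sum>k=1..K. a k * q powi (int n - 2 * int k - 1)))"
      if "q \<in> arg_sector \<delta>" for q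
    proof -
      have "q \<noteq> 0"
        using that by (simp add: arg_sector_def)
      then have "deriv (\<lambda>s. boole_sum (2 * L + 2) s q) (- of_nat n) =
          1/4 * q powi (int n - 1) - 1/2 * euler_poly n q * Ln q
          - 1/2 * (\<Sum>k=1..L. a k * q powi (int n - 2 * int k - 1))"
        unfolding a_def by (rule deriv_boole_sum) (simp add: L_def)
      moreover have "(\<Sum>k=1..L. a k * q powi (int n - 2 * int k - 1)) =
          (\<Sum>k=1..K. a k * q powi (int n - 2 * int k - 1)) + (\<Sum>k=K+1..L. a k * q powi (int n - 2 * int k - 1))"
        using sum.ub_add_nat[of 1 K "\<lambda>k. a k * q powi (int n - 2 * int k - 1)" "n + 2"]
        by (simp add: L_def add_ac)
      ultimately show ?thesis
        by (simp add: algebra_simps)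
    qed
    then show "\<forall>\<^sub>F q in F. ?err q + - 1/2 * (\<Sum>k=K+1..L. a k * q powi (int n - 2 * int k - 1)) =
       deriv (\<lambda>s. alt_hurwitz_zeta s q) (- of_nat n) -
        (1/4 * q powi (int n - 1) - 1/2 * euler_poly n q * Ln q
         - 1/2 * (\<Sum>k=1..K. a k * q powi (int n - 2 * int k - 1)))"
      by (simp add: F_def eventually_inf_principal)
  qed
  finally show "(\<lambda>q::complex.
        deriv (\<lambda>s. alt_hurwitz_zeta s q) (- of_nat n) -
        (1/4 * q powi (int n - 1) - 1/2 * euler_poly n q * Ln q
         - 1/2 * (\<Sum>k=1..K. euler_poly (2*k+1) 0 *
             (\<Sum>j=0..min n (2*k).
                of_nat (n choose j) * ((-1) ^ j / (2 * of_nat k - of_nat j + 1))) *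
             q powi (int n - 2 * int k - 1))))
    \<in> O[inf at_infinity (principal (arg_sector \<delta>))](\<lambda>q. of_real (norm q powi (int n - 2 * int K - 3)))"
    unfolding a_def F_def h_def .
qed

end
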